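(* Let $F$ be a continuous distribution function on $\mathbb{R}$ with density $f$. Let $n_1,n_2\ge 1$ be integers, $n=n_1+n_2$, and let $\alpha,\alpha^*,\beta,\beta^*,\delta,\delta^*>0$. Let $U_1,\dots,U_n$ be mutually independent random variables and $V_1,\dots,V_n$ be mutually independent random variables such that $U_i\sim Kw\text{-}G(\alpha,\beta,F)$ and $V_i\sim Kw\text{-}G(\alpha,\delta,F)$ for $i=1,\dots,n_1$, and $U_i\sim Kw\text{-}G(\alpha^*,\beta^*,F)$ and $V_i\sim Kw\text{-}G(\alpha^*,\delta^*,F)$ for $i=n_1+1,\dots,n$. Suppose that $$(\underbrace{\beta,\dots,\beta}_{n_1},\underbrace{\beta^*,\dots,\beta^*}_{n_2})\stackrel{m}{\succeq}(\underbrace{\delta,\dots,\delta}_{n_1},\underbrace{\delta^*,\dots,\delta^*}_{n_2}).$$ (i) If $\alpha>\alpha^*$, $\beta>\beta^*$ and $\delta>\delta^*$, then $U_{1:n}\ge_{lr}V_{1:n}$. (ii) If $\alpha>\alpha^*$, $\beta<\beta^*$ and $\delta<\delta^*$, then $U_{1:n}\le_{lr}V_{1:n}$.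
   Context: For $\alpha,\beta>0$ and a distribution function $F$, $X\sim Kw\text{-}G(\alpha,\beta,F)$ means that $X$ has distribution function $x\mapsto 1-(1-F^{\alpha}(x))^{\beta}$, $x\in\mathbb{R}$, where $F^\alpha(x)=(F(x))^\alpha$. $U_{1:n}=\min(U_1,\dots,U_n)$ and $V_{1:n}=\min(V_1,\dots,V_n)$. For real vectors $\mathbf{x},\mathbf{y}$ of length $n$ with increasing rearrangements $x_{(1)}\le\cdots\le x_{(n)}$ and $y_{(1)}\le\cdots\le y_{(n)}$, $\mathbf{x}\stackrel{m}{\succeq}\mathbf{y}$ ($\mathbf{x}$ majorizes $\mathbf{y}$) means $\sum_{i=1}^j x_{(i)}\le\sum_{i=1}^j y_{(i)}$ for $j=1,\dots,n-1$ and $\sum_{i=1}^n x_{(i)}=\sum_{i=1}^n y_{(i)}$. Likelihood ratio order: for absolutely continuous $X,Y$, $X\le_{lr}Y$ (equivalently $Y\ge_{lr}X$) means that, for suitable versions $f_X,f_Y$ of their densities, $f_Y(t)/f_X(t)$ is increasing in $t$ (at points where numerator and denominator are not both zero, with $a/0=\infty$ for $a>0$, as usual). "Increasing" means nondecreasing. *)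

theory Defs
  imports "HOL-Probability.Probability"
begin

definition distribution_function :: "(real \<Rightarrow> real) \<Rightarrow> bool" where
  "distribution_function F \<longleftrightarrow> (\<exists>D. real_distribution D \<and> F = cdf D)"

definition has_density :: "(real \<Rightarrow> real) \<Rightarrow> (real \<Rightarrow> real) \<Rightarrow> bool" where
  "has_density F f \<longleftrightarrow> f \<in> borel_measurable borel \<and> (\<forall>t. 0 \<le> f t) \<and>
     (\<forall>x. ennreal (F x) = (\<integral>\<^sup>+t\<in>{..x}. ennreal (f t) \<partial>lborel))"

definition kw_G_cdf :: "real \<Rightarrow> real \<Rightarrow> (real \<Rightarrow> real) \<Rightarrow> real \<Rightarrow> real" where
  "kw_G_cdf \<alpha> \<beta> F x = 1 - (1 - F x powr \<alpha>) powr \<beta>"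

definition kw_G :: "'a measure \<Rightarrow> ('a \<Rightarrow> real) \<Rightarrow> real \<Rightarrow> real \<Rightarrow> (real \<Rightarrow> real) \<Rightarrow> bool" where
  "kw_G M X \<alpha> \<beta> F \<longleftrightarrow>
     X \<in> borel_measurable M \<and> cdf (distr M borel X) = kw_G_cdf \<alpha> \<beta> F"

definition majorizes :: "real list \<Rightarrow> real list \<Rightarrow> bool" where
  "majorizes xs ys \<longleftrightarrow> length xs = length ys \<and>
     (\<forall>j\<in>{1..length xs - 1}. sum_list (take j (sort xs)) \<le> sum_list (take j (sort ys))) \<and>
     sum_list xs = sum_list ys"

text \<open>
  Likelihood ratio order of absolutely continuous random variables, possibly living on
  different probability spaces.  The versions of the densities are real-valued; their ratio is
  formed in \<^typ>\<open>ennreal\<close>, where division of a nonzero element by \<open>0\<close> gives \<open>\<infinity>\<close>.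
\<close>

definition lr_le ::
  "'a measure \<Rightarrow> ('a \<Rightarrow> real) \<Rightarrow> 'b measure \<Rightarrow> ('b \<Rightarrow> real) \<Rightarrow> bool" where
  "lr_le M X N Y \<longleftrightarrow> (\<exists>fX fY :: real \<Rightarrow> real.
     (\<forall>t. 0 \<le> fX t) \<and> (\<forall>t. 0 \<le> fY t) \<and>
     distributed M lborel X (\<lambda>t. ennreal (fX t)) \<and>
     distributed N lborel Y (\<lambda>t. ennreal (fY t)) \<and>
     mono_on {t. \<not> (fX t = 0 \<and> fY t = 0)} (\<lambda>t. ennreal (fY t) / ennreal (fX t)))"

definition min_upto :: "nat \<Rightarrow> (nat \<Rightarrow> 'a \<Rightarrow> real) \<Rightarrow> 'a \<Rightarrow> real" where
  "min_upto n X \<omega> = Min ((\<lambda>i. X i \<omega>) ` {1..n})"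

end

theory Submission
  imports Defs
begin

text \<open>
  Write \<open>a = n1 \<beta>\<close>, \<open>b = n2 \<beta>'\<close>, \<open>a' = n1 \<delta>\<close>, \<open>b' = n2 \<delta>'\<close>, so that \<open>a + b = a' + b'\<close>, and
  majorization says \<open>a \<ge> a'\<close> in (i) and \<open>a \<le> a'\<close> in (ii). The survival function of
  the minimum of the \<open>U i\<close> is \<open>S (F x)\<close> with \<open>S u = (1 - u^\<alpha>)^a (1 - u^\<alpha>')^b\<close>, and the ratio of
  the two densities at \<open>u = F t\<close> is
  \<open>((1 - u^\<alpha>) / (1 - u^\<alpha>'))^(a - a') (a \<alpha> k + b \<alpha>') / (a' \<alpha> k + b' \<alpha>')\<close> with
  \<open>k = u^(\<alpha> - \<alpha>') (1 - u^\<alpha>') / (1 - u^\<alpha>)\<close>. Both the base of the power and \<open>k\<close> increase in \<open>u\<close>,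
  because the chord slope \<open>(x^c - 1) / (x - 1)\<close> of the convex function \<open>x^c\<close>, \<open>c = \<alpha> / \<alpha>' > 1\<close>,
  increases in \<open>x\<close>: take \<open>x = u^\<alpha>'\<close> and \<open>x = u^(-\<alpha>')\<close>.
  As \<open>F\<close> need not be differentiable, the density of the minimum comes not from the chain rule
  but from the probability integral transform: \<open>F\<close> is uniformly distributed under the
  measure with density \<open>f\<close>.
\<close>

section \<open>Monotone quotients of powers\<close>

text \<open>Convexity of \<open>x powr c\<close> makes the chord slope from the point 1 increase.
  The hypothesis \<open>side\<close> puts \<open>x\<close> and \<open>y\<close> on the same side of
  1, so clearing the denominators keeps the direction of the inequality.\<close>

lemma powr_minus_one_cross_mono:
  fixes c x y :: real
  assumes c: "1 \<le> c" and pos: "0 < x" and xy: "x \<le> y" and side: "y < 1 \<or> 1 < x"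
  shows "(x powr c - 1) * (y - 1) \<le> (y powr c - 1) * (x - 1)"
proof (cases "x = y")
  case False
  have conv: "convex_on {0<..} (\<lambda>x::real. x powr c)"
    using c by (rule powr_convex)
  from side show ?thesis
  proof
    assume "y < 1"
    then have "(x powr c - 1 powr c) / (x - 1) \<le> (y powr c - 1 powr c) / (y - 1)"
      using convex_on_slope_le(2)[OF conv, of x 1 y] pos xy False by simp
    with \<open>y < 1\<close> xy show ?thesis by (simp add: field_simps)
  next
    assume "1 < x"
    then have "(1 powr c - x powr c) / (1 - x) \<le> (1 powr c - y powr c) / (1 - y)"
      using convex_on_slope_le(1)[OF conv, of 1 y x] pos xy False by simp
    with \<open>1 < x\<close> xy show ?thesis by (simp add: field_simps)
  qed
qed simp

lemma powr_less_one_pos: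
  fixes u p :: real
  assumes "0 < u" "u < 1" "0 < p"
  shows "u powr p < 1"
  using powr_less_mono2[of p u 1] assms by simp

text \<open>This is the chord slope for exponent \<open>p/q\<close> at the point
  \<open>u powr q\<close> below 1.\<close>

lemma one_minus_powr_quotient_mono:
  fixes p q u v :: real
  assumes "0 < q" "q \<le> p" "0 < u" "u \<le> v" "v < 1"
  shows "(1 - u powr p) / (1 - u powr q) \<le> (1 - v powr p) / (1 - v powr q)"
proof -
  have "u powr q < 1" "v powr q < 1"
    using assms powr_less_one_pos by auto
  moreover have "u powr q \<le> v powr q"
    using assms by (simp add: powr_mono2)
  moreover have "((u powr q) powr (p/q) - 1) * (v powr q - 1) \<le> ((v powr q) powr (p/q) - 1) * (u powr q - 1)"
    using assms calculation by (intro powr_minus_one_cross_mono) auto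
  ultimately show ?thesis
    using assms by (simp add: powr_powr field_simps)
qed

text \<open>Dividing numerator and denominator by \<open>u powr p\<close> gives the reciprocal of
  the chord slope at \<open>u powr - q\<close>, a point above 1 that decreases in \<open>u\<close>.
  The slope thus decreases and its reciprocal increases.\<close>

lemma powr_hazard_quotient_mono:
  fixes p q u v :: real
  assumes "0 < q" "q \<le> p" "0 < u" "u \<le> v" "v < 1"
  shows "u powr (p - q) * (1 - u powr q) / (1 - u powr p)
       \<le> v powr (p - q) * (1 - v powr q) / (1 - v powr p)"
proof -
  have *: "w powr (p - q) * (1 - w powr q) / (1 - w powr p) = (w powr - q - 1) / (w powr - p - 1)"
    if "0 < w" "w < 1" for w :: real
  proof -
    have "w powr p < 1" "w powr p > 0" "w powr q > 0"
      using that assms powr_less_one_pos[of w p] by auto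
    then show ?thesis
      using that by (simp add: powr_diff powr_minus field_simps)
  qed
  have gt: "1 < w powr - r" if "0 < w" "w < 1" "0 < r" for w r :: real
    using powr_less_one_pos[of w r] that by (simp add: powr_minus one_less_inverse)
  have "v powr - q \<le> u powr - q"
    using assms by (simp add: powr_mono2')
  then have "((v powr - q) powr (p/q) - 1) * (u powr - q - 1) \<le> ((u powr - q) powr (p/q) - 1) * (v powr - q - 1)"
    using assms gt[of v q] by (intro powr_minus_one_cross_mono) auto
  then have "(v powr - p - 1) * (u powr - q - 1) \<le> (u powr - p - 1) * (v powr - q - 1)"
    using assms by (simp add: powr_powr)
  then have "(u powr - q - 1) / (u powr - p - 1) \<le> (v powr - q - 1) / (v powr - p - 1)"
    using gt[of v p] gt[of u p] assms by (simp add: field_simps)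
  then show ?thesis
    using assms by (simp add: *)
qed

text \<open>After clearing denominators the difference of the two sides is the determinant
  \<open>a * d - b * c\<close> times \<open>y - x\<close>.\<close>

lemma linear_fractional_mono:
  fixes a b c d x y :: real
  assumes "0 < c" "0 < d" "b * c \<le> a * d" "0 \<le> x" "x \<le> y"
  shows "(a * x + b) / (c * x + d) \<le> (a * y + b) / (c * y + d)"
proof -
  have "0 < c * x + d" "0 < c * y + d"
    using assms by (auto intro!: add_nonneg_pos)
  moreover have "0 \<le> (a * d - b * c) * (y - x)"
    using assms by simp
  ultimately show ?thesis
    by (simp add: field_simps)
qed

section \<open>The probability integral transform\<close>

text \<open>A cdf may have flat pieces and hence no inverse. Instead the set where it is at most
  \<open>u\<close> is squeezed between \<open>{..x}\<close> with value \<open>u\<close> at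
  \<open>x\<close> and the sets \<open>{..y}\<close> with value \<open>v > u\<close> at
  \<open>y\<close>, as \<open>v\<close> decreases to \<open>u\<close>.\<close>

lemma (in real_distribution) cdf_distributed_uniform:
  assumes cont: "continuous_on UNIV (cdf M)"
  shows "distributed M lborel (cdf M) (\<lambda>u. indicator {0..1} u)"
proof -
  let ?F = "cdf M"
  have meas: "?F \<in> borel_measurable borel"
    using cont by (rule borel_measurable_continuous_onI)
  \<comment> \<open>The limits 0 and 1 at the two ends bracket \<open>u\<close>, so the intermediate
    value theorem applies; the values 0 and 1 themselves may fail to be attained.\<close>
  have attained: "\<exists>x. ?F x = u" if "0 < u" "u < 1" for u
  proof -
    have "eventually (\<lambda>x. ?F x < u) at_bot"
      using order_tendstoD(2)[OF cdf_lim_at_bot] that by simp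
    then obtain a where a: "?F a < u"
      by (auto simp: eventually_at_bot_linorder)
    have "eventually (\<lambda>x. u < ?F x) at_top"
      using order_tendstoD(1)[OF cdf_lim_at_top_prob] that by simp
    then obtain b where b: "u < ?F b"
      by (auto simp: eventually_at_top_linorder)
    have "a \<le> b"
      using a b cdf_nondecreasing[of b a] by (meson le_cases less_le_trans less_trans not_less)
    then show ?thesis
      using IVT'[of ?F a u b] a b continuous_on_subset[OF cont] by auto
  qed
  have below: "prob {t. ?F t \<le> u} \<le> v" if uv: "u < v" "0 < v" "v < 1" for u v
  proof -
    obtain y where y: "?F y = v"
      using attained[OF uv(2,3)] by blast
    have "{t. ?F t \<le> u} \<subseteq> {..y}"
    proof
      fix t assume "t \<in> {t. ?F t \<le> u}"
      then have "?F t < ?F y"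
        using y that by simp
      then show "t \<in> {..y}"
        using cdf_nondecreasing[of y t] by (meson atMost_iff le_cases not_less)
    qed
    then have "prob {t. ?F t \<le> u} \<le> prob {..y}"
      by (intro finite_measure_mono) auto
    then show ?thesis
      using y by (simp add: cdf_def)
  qed
  have "prob {t. ?F t \<le> u} = u" if u: "0 \<le> u" "u \<le> 1" for u
  proof (cases "u = 1")
    case True
    then show ?thesis
      using cdf_bounded_prob prob_space by simp
  next
    case False
    have "prob {t. ?F t \<le> u} \<le> u"
    proof (rule dense_ge_bounded[of u 1])
      show "u < 1" using u False by simp
    qed (use u below in auto)
    moreover have "u \<le> prob {t. ?F t \<le> u}"
    proof (cases "u = 0")
      case False
      then obtain x where x: "?F x = u"
        using attained u \<open>u \<noteq> 1\<close> by force
      have "prob {..x} \<le> prob {t. ?F t \<le> u}"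
        using x cdf_nondecreasing meas by (intro finite_measure_mono) auto
      then show ?thesis
        using x by (simp add: cdf_def)
    qed simp
    ultimately show ?thesis by simp
  qed
  then show ?thesis
    using uniform_distrI_borel_atLeastAtMost[of ?F 0 1] meas by (simp add: ennreal_indicator)
qed

lemma has_density_imp_real_distribution:
  assumes "distribution_function F" "has_density F f"
  shows "real_distribution (density lborel (\<lambda>t. ennreal (f t)))"
    and "cdf (density lborel (\<lambda>t. ennreal (f t))) = F"
proof -
  let ?E = "density lborel (\<lambda>t. ennreal (f t))"
  obtain D where D: "real_distribution D" and F: "F = cdf D"
    using assms(1) by (auto simp: distribution_function_def)
  interpret D: real_distribution D by fact
  have [measurable]: "f \<in> borel_measurable borel"
    using assms(2) by (simp add: has_density_def)
  have atMost: "emeasure ?E {..x} = ennreal (F x)" for x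
    using assms(2) by (simp add: has_density_def emeasure_density)
  \<comment> \<open>The total mass is the limit of the masses \<open>F i\<close> of growing
    half-lines, hence 1.\<close>
  have "(\<lambda>i. ennreal (F (real i))) \<longlonglongrightarrow> ennreal 1"
    unfolding F by (intro tendsto_ennrealI D.cdf_lim_infty_prob)
  moreover have "(\<lambda>i. emeasure ?E {..real i}) \<longlonglongrightarrow> emeasure ?E (\<Union>i. {..real i})"
    by (intro Lim_emeasure_incseq) (auto simp: incseq_def)
  moreover have "(\<Union>i. {..real i}) = space ?E"
    by (auto intro: real_arch_simple)
  ultimately have "emeasure ?E (space ?E) = 1"
    unfolding atMost by (auto dest: LIMSEQ_unique)
  then interpret E: prob_space ?E
    by (rule prob_spaceI)
  show "real_distribution ?E"
    by unfold_locales auto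
  show "cdf ?E = F"
    by (rule ext) (simp add: cdf_def measure_def atMost F D.cdf_nonneg)
qed

section \<open>A density for a distribution function of the form \<open>H (F x)\<close>\<close>

text \<open>The derivative may blow up at an endpoint, as \<open>u powr (\<alpha> - 1)\<close> does
  at 0 for \<alpha> < 1. The fundamental theorem is therefore used in its improper form, with
  boundary limits supplied by continuity of \<open>H\<close>.\<close>

lemma nn_integral_derivative_Ioo:
  fixes H h :: "real \<Rightarrow> real"
  assumes ab: "a < b" and H: "continuous_on {a..b} H"
    and deriv: "\<And>u. a < u \<Longrightarrow> u < b \<Longrightarrow> (H has_real_derivative h u) (at u)"
    and h: "continuous_on {a<..<b} h"
    and nonneg: "\<And>u. a < u \<Longrightarrow> u < b \<Longrightarrow> 0 \<le> h u"
  shows "(\<integral>\<^sup>+u. ennreal (h u) * indicator {a<..<b} u \<partial>lborel) = ennreal (H b - H a)"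
proof -
  have cont: "isCont h u" if "a < u" "u < b" for u
    using h that by (simp add: continuous_on_eq_continuous_at)
  have lim: "((H \<circ> real_of_ereal) \<longlongrightarrow> H a) (at_right (ereal a))"
    "((H \<circ> real_of_ereal) \<longlongrightarrow> H b) (at_left (ereal b))"
    unfolding ereal_tendsto_simps1 using ab H
    by (auto intro: continuous_on_Icc_at_rightD continuous_on_Icc_at_leftD)
  note FTC = interval_integral_FTC_nonneg[of "ereal a" "ereal b" H h, OF _ _ _ _ lim]
  have int: "set_integrable lborel {a<..<b} h"
    using FTC(1) ab deriv cont nonneg by auto
  have val: "(LINT u:{a<..<b}|lborel. h u) = H b - H a"
    using FTC(2) ab deriv cont nonneg by (auto simp: interval_lebesgue_integral_def)
  have "(\<integral>\<^sup>+u. ennreal (h u) * indicator {a<..<b} u \<partial>lborel)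
      = (\<integral>\<^sup>+u. ennreal (indicator {a<..<b} u *\<^sub>R h u) \<partial>lborel)"
    by (intro nn_integral_cong) (auto simp: indicator_def)
  also have "\<dots> = ennreal (LINT u:{a<..<b}|lborel. h u)"
    unfolding set_lebesgue_integral_def
    using int nonneg by (intro nn_integral_eq_integral) (auto simp: set_integrable_def indicator_def)
  finally show ?thesis
    by (simp add: val)
qed

text \<open>Integrating \<open>h (F t) * f t\<close> over \<open>t \<le> x\<close> means integrating
  \<open>h (F t)\<close> against the law with density \<open>f\<close>. Under that law
  \<open>F\<close> is uniform, so the result is the integral of \<open>h\<close> over
  \<open>(0, F x)\<close>, which is \<open>H (F x)\<close>. The levels 0 and 1 of \<open>F\<close>
  carry no mass, so the density may be 0 there.\<close>

lemma (in prob_space) distributed_of_cdf_compose: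
  fixes F f H h :: "real \<Rightarrow> real" and X :: "'a \<Rightarrow> real"
  assumes F: "distribution_function F" "continuous_on UNIV F" "has_density F f"
    and X: "X \<in> borel_measurable M" "\<And>x. prob {\<omega> \<in> space M. X \<omega> \<le> x} = H (F x)"
    and H: "continuous_on {0..1} H" "H 0 = 0"
    and deriv: "\<And>u. 0 < u \<Longrightarrow> u < 1 \<Longrightarrow> (H has_real_derivative h u) (at u)"
    and h: "continuous_on {0<..<1} h" "h \<in> borel_measurable borel"
    and nonneg: "\<And>u. 0 < u \<Longrightarrow> u < 1 \<Longrightarrow> 0 \<le> h u"
  shows "distributed M lborel X
    (\<lambda>t. ennreal (if 0 < F t \<and> F t < 1 then h (F t) * f t else 0))"
proof -
  let ?g = "\<lambda>t. if 0 < F t \<and> F t < 1 then h (F t) * f t else 0"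
  define D where "D = density lborel (\<lambda>t. ennreal (f t))"
  interpret D: real_distribution D
    unfolding D_def by (rule has_density_imp_real_distribution[OF F(1,3)])
  have cdf_D: "cdf D = F"
    unfolding D_def by (rule has_density_imp_real_distribution[OF F(1,3)])
  have f[measurable]: "f \<in> borel_measurable borel" and f0: "0 \<le> f t" for t
    using F(3) by (auto simp: has_density_def)
  have [measurable]: "F \<in> borel_measurable borel"
    using F(2) by (rule borel_measurable_continuous_onI)
  note h(2)[measurable]
  have unif: "distributed D lborel F (\<lambda>u. indicator {0..1} u)"
    using D.cdf_distributed_uniform F(2) by (simp add: cdf_D)
  have F01: "0 \<le> F x" "F x \<le> 1" for x
    using D.cdf_nonneg[of x] D.cdf_bounded_prob[of x] by (auto simp: cdf_D)
  have F_mono: "F x \<le> F y" if "x \<le> y" for x y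
    using D.cdf_nondecreasing[OF that] by (simp add: cdf_D)
  \<comment> \<open>The set \<open>{t. F t \<le> F x}\<close> contains \<open>{..x}\<close> and both
    have mass \<open>F x\<close>; they differ only by a null set on which \<open>F\<close> is flat.
    This turns the condition on \<open>t\<close> into one on \<open>F t\<close>.\<close>
  have level: "AE t in D. F t \<le> F x \<longleftrightarrow> t \<le> x" for x
  proof -
    have "emeasure D {t. F t \<le> F x} = emeasure (distr D lborel F) {..F x}"
      by (simp add: emeasure_distr vimage_def)
    also have "\<dots> = (\<integral>\<^sup>+u. indicator {0..1} u * indicator {..F x} u \<partial>lborel)"
      unfolding distributed_distr_eq_density[OF unif] by (simp add: emeasure_density)
    also have "\<dots> = (\<integral>\<^sup>+u. indicator {0..F x} u \<partial>lborel)"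
      using F01[of x] by (intro nn_integral_cong) (simp add: indicator_def)
    also have "\<dots> = emeasure D {..x}"
      using F01[of x] by (simp add: D.emeasure_eq_measure cdf_def2[symmetric] cdf_D)
    finally have "emeasure D ({t. F t \<le> F x} - {..x}) = 0"
      using F_mono by (subst emeasure_Diff) auto
    then have "AE t in D. t \<notin> {t. F t \<le> F x} - {..x}"
      by (intro AE_not_in) (auto simp: null_sets_def)
    then show ?thesis
      using F_mono by (auto elim: eventually_mono)
  qed
  show ?thesis
  proof (rule distributedI_borel_atMost)
    show "X \<in> borel_measurable M" by (rule X(1))
    show "?g \<in> borel_measurable borel" by measurable
    show "AE t in lborel. 0 \<le> ?g t" using nonneg f0 by simp
    fix x
    show "emeasure M {\<omega> \<in> space M. X \<omega> \<le> x} = ennreal (H (F x))"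
      by (simp add: emeasure_eq_measure X(2))
    let ?k = "\<lambda>u. ennreal (h u) * indicator {0<..<1} u * indicator {..F x} u"
    have "(\<integral>\<^sup>+t. ennreal (?g t * indicator {..x} t) \<partial>lborel)
        = (\<integral>\<^sup>+t. ennreal (f t) * (ennreal (h (F t)) * indicator {0<..<1} (F t) * indicator {..x} t) \<partial>lborel)"
      using nonneg f0 by (intro nn_integral_cong)
        (auto simp: indicator_def ennreal_mult'' mult.commute)
    also have "\<dots> = (\<integral>\<^sup>+t. ennreal (h (F t)) * indicator {0<..<1} (F t) * indicator {..x} t \<partial>D)"
      unfolding D_def by (subst nn_integral_density) auto
    also have "\<dots> = (\<integral>\<^sup>+t. ?k (F t) \<partial>D)"
      using level[of x] by (intro nn_integral_cong_AE) (auto elim!: eventually_mono simp: indicator_def)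
    also have "\<dots> = (\<integral>\<^sup>+u. ennreal (indicator {0..1} u) * ?k u \<partial>lborel)"
      using distributed_nn_integral[OF unif, of ?k] by (simp add: ennreal_indicator)
    \<comment> \<open>The two integrands can differ only at the single point
      \<open>u = F x\<close>.\<close>
    also have "\<dots> = (\<integral>\<^sup>+u. ennreal (h u) * indicator {0<..<F x} u \<partial>lborel)"
      using F01[of x] AE_lborel_singleton[of "F x"]
      by (intro nn_integral_cong_AE) (auto elim!: eventually_mono simp: indicator_def)
    also have "\<dots> = ennreal (H (F x))"
    proof (cases "F x = 0")
      case True
      then show ?thesis by (simp add: H(2))
    next
      case False
      then have "(\<integral>\<^sup>+u. ennreal (h u) * indicator {0<..<F x} u \<partial>lborel) = ennreal (H (F x) - H 0)"
        using F01[of x] deriv nonneg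
        by (intro nn_integral_derivative_Ioo continuous_on_subset[OF H(1)] continuous_on_subset[OF h(1)]) auto
      then show ?thesis by (simp add: H(2))
    qed
    finally show "(\<integral>\<^sup>+t. ennreal (?g t * indicator {..x} t) \<partial>lborel) = ennreal (H (F x))" .
  qed
qed

section \<open>The density of the minimum\<close>

text \<open>
  Survival function and hazard rate of the minimum as functions of \<open>u = F x\<close>; the shape
  parameters enter only through \<open>a = n1 \<beta>\<close> and \<open>b = n2 \<beta>'\<close>.
\<close>

definition kw_min_survival :: "real \<Rightarrow> real \<Rightarrow> real \<Rightarrow> real \<Rightarrow> real \<Rightarrow> real" where
  "kw_min_survival \<alpha> \<alpha>' a b u = (1 - u powr \<alpha>) powr a * (1 - u powr \<alpha>') powr b"

definition kw_min_hazard :: "real \<Rightarrow> real \<Rightarrow> real \<Rightarrow> real \<Rightarrow> real \<Rightarrow> real" where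
  "kw_min_hazard \<alpha> \<alpha>' a b u =
     a * (\<alpha> * u powr (\<alpha> - 1) / (1 - u powr \<alpha>)) + b * (\<alpha>' * u powr (\<alpha>' - 1) / (1 - u powr \<alpha>'))"

text \<open>The cutoff and the factor \<open>f t\<close> do not depend on \<open>a\<close> and
  \<open>b\<close>. For positive \<open>a\<close> and \<open>b\<close>, the versions for both minima
  thus vanish at the same points.\<close>

definition kw_min_density ::
  "real \<Rightarrow> real \<Rightarrow> real \<Rightarrow> real \<Rightarrow> (real \<Rightarrow> real) \<Rightarrow> (real \<Rightarrow> real) \<Rightarrow> real \<Rightarrow> real" where
  "kw_min_density \<alpha> \<alpha>' a b F f t =
     (if 0 < F t \<and> F t < 1
      then kw_min_survival \<alpha> \<alpha>' a b (F t) * kw_min_hazard \<alpha> \<alpha>' a b (F t) * f t else 0)"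

lemma kw_min_survival_pos:
  assumes "0 < \<alpha>" "0 < \<alpha>'" "0 < u" "u < 1"
  shows "0 < kw_min_survival \<alpha> \<alpha>' a b u"
  using powr_less_one_pos[of u \<alpha>] powr_less_one_pos[of u \<alpha>'] assms
  by (simp add: kw_min_survival_def)

lemma kw_min_hazard_pos:
  assumes "0 < \<alpha>" "0 < \<alpha>'" "0 < a" "0 < b" "0 < u" "u < 1"
  shows "0 < kw_min_hazard \<alpha> \<alpha>' a b u"
  using powr_less_one_pos[of u \<alpha>] powr_less_one_pos[of u \<alpha>'] assms
  by (simp add: kw_min_hazard_def add_pos_pos)

text \<open>The hazard is minus the logarithmic derivative of the survival function, which adds over
  the two factors.\<close>

lemma kw_min_survival_has_derivative:
  assumes "0 < \<alpha>" "0 < \<alpha>'" "0 < u" "u < 1"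
  shows "((\<lambda>u. 1 - kw_min_survival \<alpha> \<alpha>' a b u) has_real_derivative
    kw_min_survival \<alpha> \<alpha>' a b u * kw_min_hazard \<alpha> \<alpha>' a b u) (at u)"
proof -
  have factor: "((\<lambda>u. (1 - u powr p) powr c) has_real_derivative
      - ((1 - u powr p) powr c * (c * (p * u powr (p - 1) / (1 - u powr p))))) (at u)"
    if "0 < p" for c p
    using powr_less_one_pos[of u p] assms that
    by (auto intro!: derivative_eq_intros simp: powr_diff mult_ac)
  show ?thesis
    unfolding kw_min_survival_def kw_min_hazard_def using assms
    by (intro DERIV_cong[OF DERIV_diff[OF DERIV_const DERIV_mult[OF factor factor]]])
      (auto simp: algebra_simps)
qed

lemma (in prob_space) kw_min_distributed:
  fixes X :: "nat \<Rightarrow> 'a \<Rightarrow> real"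
  assumes F: "distribution_function F" "continuous_on UNIV F" "has_density F f"
    and n: "n1 \<ge> 1" "n2 \<ge> 1" "n = n1 + n2"
    and pos: "0 < \<alpha>" "0 < \<alpha>'" "0 < \<beta>" "0 < \<beta>'"
    and indep: "indep_vars (\<lambda>_. borel) X {1..n}"
    and kw1: "\<And>i. i \<in> {1..n1} \<Longrightarrow> kw_G M (X i) \<alpha> \<beta> F"
    and kw2: "\<And>i. i \<in> {n1 + 1..n} \<Longrightarrow> kw_G M (X i) \<alpha>' \<beta>' F"
  shows "distributed M lborel (min_upto n X)
    (\<lambda>t. ennreal (kw_min_density \<alpha> \<alpha>' (real n1 * \<beta>) (real n2 * \<beta>') F f t))"
proof -
  let ?S = "kw_min_survival \<alpha> \<alpha>' (real n1 * \<beta>) (real n2 * \<beta>')"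
  let ?h = "\<lambda>u. ?S u * kw_min_hazard \<alpha> \<alpha>' (real n1 * \<beta>) (real n2 * \<beta>') u"
  \<comment> \<open>The bound on \<open>m\<close> matters at \<open>x = 0\<close>, where
    \<open>0 powr 0\<close> is 0 but the power \<open>0 ^ 0\<close> is 1. The base does vanish when
    \<open>F x = 1\<close>.\<close>
  have power_powr: "(x powr c) ^ m = x powr (real m * c)" if "1 \<le> m" for m and x c :: real
    using that by (cases "x = 0") (simp_all add: powr_power)
  have meas: "X i \<in> borel_measurable M" if "i \<in> {1..n}" for i
    using indep that by (auto simp: indep_vars_def)
  have tail: "prob (X i -` {x<..} \<inter> space M) = (1 - F x powr p) powr q"
    if "kw_G M (X i) p q F" for i p q x
  proof -
    have [measurable]: "X i \<in> borel_measurable M"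
      using that by (simp add: kw_G_def)
    have "prob (X i -` {..x} \<inter> space M) = 1 - (1 - F x powr p) powr q"
      using that by (simp add: kw_G_def fun_eq_iff cdf_def2 measure_distr kw_G_cdf_def)
    moreover have "X i -` {x<..} \<inter> space M = space M - (X i -` {..x} \<inter> space M)"
      by auto
    ultimately show ?thesis
      by (simp add: prob_compl)
  qed
  have min_meas: "min_upto n X \<in> borel_measurable M"
    unfolding min_upto_def using meas by (intro borel_measurable_Min) auto
  have cdf_min: "prob {\<omega> \<in> space M. min_upto n X \<omega> \<le> x} = 1 - ?S (F x)" for x
  proof -
    have ne: "{1..n} \<noteq> {}"
      using n by simp
    have "{\<omega> \<in> space M. min_upto n X \<omega> \<le> x}
        = space M - (\<Inter>i\<in>{1..n}. X i -` {x<..} \<inter> space M)"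
      using ne by (auto simp: min_upto_def Min_le_iff not_less)
    moreover have "(\<Inter>i\<in>{1..n}. X i -` {x<..} \<inter> space M) \<in> events"
      using ne meas by (intro sets.finite_INT measurable_sets[of _ M borel]) auto
    ultimately have "prob {\<omega> \<in> space M. min_upto n X \<omega> \<le> x}
        = 1 - prob (\<Inter>i\<in>{1..n}. X i -` {x<..} \<inter> space M)"
      by (simp add: prob_compl)
    also have "prob (\<Inter>i\<in>{1..n}. X i -` {x<..} \<inter> space M)
        = (\<Prod>i\<in>{1..n}. prob (X i -` {x<..} \<inter> space M))"
      using ne by (intro indep_varsD_finite[OF indep]) auto
    also have "{1..n} = {1..n1} \<union> {n1 + 1..n}"
      using n by auto
    also have "(\<Prod>i\<in>\<dots>. prob (X i -` {x<..} \<inter> space M))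
        = (\<Prod>i\<in>{1..n1}. prob (X i -` {x<..} \<inter> space M)) * (\<Prod>i\<in>{n1 + 1..n}. prob (X i -` {x<..} \<inter> space M))"
      by (intro prod.union_disjoint) auto
    also have "\<dots> = ((1 - F x powr \<alpha>) powr \<beta>) ^ n1 * ((1 - F x powr \<alpha>') powr \<beta>') ^ n2"
      using n by (simp add: tail[OF kw1] tail[OF kw2])
    also have "\<dots> = ?S (F x)"
      using n by (simp add: kw_min_survival_def power_powr[of n1] power_powr[of n2])
    finally show ?thesis .
  qed
  \<comment> \<open>A base vanishes at each endpoint: \<open>u\<close> at 0 and
    \<open>1 - u powr p\<close> at 1. Positive exponents keep the powers continuous there.\<close>
  have "continuous_on {0..1} (\<lambda>u. 1 - ?S u)"
    unfolding kw_min_survival_def using pos n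
    by (intro continuous_intros continuous_on_powr') (simp_all add: powr_le1)
  moreover have "continuous_on {0<..<1} ?h"
  proof -
    have "u powr p \<noteq> 1" if "u \<in> {0<..<1}" "0 < p" for u p :: real
      using powr_less_one_pos[of u p] that by simp
    then show ?thesis
      unfolding kw_min_survival_def kw_min_hazard_def using pos
      by (intro continuous_intros) (simp_all add: less_imp_neq)
  qed
  moreover have "?h \<in> borel_measurable borel"
    unfolding kw_min_survival_def kw_min_hazard_def by measurable
  moreover have "0 \<le> ?h u" if "0 < u" "u < 1" for u
    using that pos n by (intro mult_nonneg_nonneg less_imp_le[OF kw_min_survival_pos] less_imp_le[OF kw_min_hazard_pos]) auto
  moreover have "1 - ?S 0 = 0"
    using pos by (simp add: kw_min_survival_def)
  ultimately show ?thesis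
    unfolding kw_min_density_def using pos
    by (intro distributed_of_cdf_compose[OF F min_meas cdf_min])
      (auto intro: kw_min_survival_has_derivative)
qed

section \<open>The likelihood ratio of the two minima\<close>

text \<open>The factor \<open>f t\<close> cancels. Equal sums give
  \<open>b - b' = - (a - a')\<close>, which merges the survival ratio into one power. A common
  factor of the two hazards cancels too, leaving a linear fractional function of
  \<open>k\<close>.\<close>

lemma kw_min_density_ratio:
  assumes pos: "0 < \<alpha>" "0 < \<alpha>'" "0 < a" "0 < b" "0 < a'" "0 < b'" and sum: "a + b = a' + b'"
    and t: "0 < F t" "F t < 1" "f t \<noteq> 0"
  defines "k \<equiv> F t powr (\<alpha> - \<alpha>') * (1 - F t powr \<alpha>') / (1 - F t powr \<alpha>)"
  shows "kw_min_density \<alpha> \<alpha>' a b F f t / kw_min_density \<alpha> \<alpha>' a' b' F f t =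
    ((1 - F t powr \<alpha>) / (1 - F t powr \<alpha>')) powr (a - a') *
    ((a * \<alpha> * k + b * \<alpha>') / (a' * \<alpha> * k + b' * \<alpha>'))"
proof -
  let ?u = "F t"
  have P: "0 < 1 - ?u powr \<alpha>" "0 < 1 - ?u powr \<alpha>'"
    using powr_less_one_pos[of ?u] pos t by auto
  have haz: "kw_min_hazard \<alpha> \<alpha>' c d ?u = (c * \<alpha> * k + d * \<alpha>') * (?u powr (\<alpha>' - 1) / (1 - ?u powr \<alpha>'))" for c d
  proof -
    have "?u powr (\<alpha> - 1) = ?u powr (\<alpha> - \<alpha>') * ?u powr (\<alpha>' - 1)"
      by (simp flip: powr_add)
    then have "?u powr (\<alpha> - 1) / (1 - ?u powr \<alpha>) = k * (?u powr (\<alpha>' - 1) / (1 - ?u powr \<alpha>'))"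
      using P by (simp add: k_def)
    then have "\<alpha> * ?u powr (\<alpha> - 1) / (1 - ?u powr \<alpha>) = \<alpha> * k * (?u powr (\<alpha>' - 1) / (1 - ?u powr \<alpha>'))"
      by (simp only: mult.assoc flip: times_divide_eq_right)
    then show ?thesis
      unfolding kw_min_hazard_def by (simp add: distrib_right add_divide_distrib)
  qed
  have "kw_min_survival \<alpha> \<alpha>' a b ?u / kw_min_survival \<alpha> \<alpha>' a' b' ?u
      = (1 - ?u powr \<alpha>) powr (a - a') * (1 - ?u powr \<alpha>') powr (b - b')"
    using P by (simp add: kw_min_survival_def powr_diff)
  also have "b - b' = - (a - a')"
    using sum by simp
  finally have surv: "kw_min_survival \<alpha> \<alpha>' a b ?u / kw_min_survival \<alpha> \<alpha>' a' b' ?u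
      = ((1 - ?u powr \<alpha>) / (1 - ?u powr \<alpha>')) powr (a - a')"
    using P by (simp add: powr_minus_divide powr_divide del: minus_diff_eq)
  have haz_ratio: "kw_min_hazard \<alpha> \<alpha>' a b ?u / kw_min_hazard \<alpha> \<alpha>' a' b' ?u = (a * \<alpha> * k + b * \<alpha>') / (a' * \<alpha> * k + b' * \<alpha>')"
    unfolding haz using P t pos by simp
  show ?thesis
    using t by (simp add: kw_min_density_def flip: surv haz_ratio)
qed

text \<open>This serves both parts of the theorem: the minimum with the larger weight on the larger
  exponent \<alpha> is the larger one, and the second part exchanges the roles. The density ratio is
  a product of two nonnegative increasing factors.\<close>

lemma lr_le_of_kw_min_densities:
  assumes F: "distribution_function F" and f: "\<And>t. 0 \<le> f t"
    and pos: "0 < \<alpha>'" "\<alpha>' < \<alpha>" "0 < a" "0 < b" "0 < a'" "0 < b'"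
    and sum: "a + b = a' + b'" and le: "a' \<le> a"
    and X: "distributed M lborel X (\<lambda>t. ennreal (kw_min_density \<alpha> \<alpha>' a b F f t))"
    and Y: "distributed N lborel Y (\<lambda>t. ennreal (kw_min_density \<alpha> \<alpha>' a' b' F f t))"
  shows "lr_le N Y M X"
proof -
  let ?g = "kw_min_density \<alpha> \<alpha>' a b F f" and ?g' = "kw_min_density \<alpha> \<alpha>' a' b' F f"
  obtain D where "real_distribution D" and F_cdf: "F = cdf D"
    using F by (auto simp: distribution_function_def)
  then interpret D: real_distribution D by simp
  have g_pos: "0 < kw_min_density \<alpha> \<alpha>' c d F f t"
    if "0 < F t" "F t < 1" "f t \<noteq> 0" "0 < c" "0 < d" for c d t
    using that pos f[of t]
    by (simp add: kw_min_density_def kw_min_survival_pos kw_min_hazard_pos)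
  have g_zero: "kw_min_density \<alpha> \<alpha>' c d F f t = 0"
    if "\<not> (0 < F t \<and> F t < 1 \<and> f t \<noteq> 0)" for c d t
    using that by (auto simp: kw_min_density_def)
  have nonneg: "0 \<le> ?g t" "0 \<le> ?g' t" for t
    using g_pos[of t] g_zero[of t] pos by (metis less_imp_le order_refl)+
  have "ennreal (?g s) / ennreal (?g' s) \<le> ennreal (?g t) / ennreal (?g' t)"
    if s: "\<not> (?g' s = 0 \<and> ?g s = 0)" and t: "\<not> (?g' t = 0 \<and> ?g t = 0)" and st: "s \<le> t" for s t
  proof -
    have s': "0 < F s" "F s < 1" "f s \<noteq> 0" and t': "0 < F t" "F t < 1" "f t \<noteq> 0"
      using s t g_zero by blast+
    have Fst: "F s \<le> F t"
      using D.cdf_nondecreasing[OF st] by (simp add: F_cdf)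
    define k where "k u = u powr (\<alpha> - \<alpha>') * (1 - u powr \<alpha>') / (1 - u powr \<alpha>)" for u
    define R where "R u = (1 - u powr \<alpha>) / (1 - u powr \<alpha>')" for u
    have P: "0 < 1 - F s powr \<alpha>" "0 < 1 - F s powr \<alpha>'" "0 < 1 - F t powr \<alpha>" "0 < 1 - F t powr \<alpha>'"
      using powr_less_one_pos pos s' t' by auto
    have k: "0 \<le> k (F s)" "k (F s) \<le> k (F t)"
      using P powr_hazard_quotient_mono[of \<alpha>' \<alpha> "F s" "F t"] pos s' t' Fst by (auto simp: k_def)
    have R: "0 \<le> R (F s)" "R (F s) \<le> R (F t)"
      using P one_minus_powr_quotient_mono[of \<alpha>' \<alpha> "F s" "F t"] pos s' t' Fst by (auto simp: R_def)
    have "b \<le> b'"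
      using sum le by simp
    \<comment> \<open>This is the determinant condition for the fraction in \<open>k\<close>, from
      \<open>b \<le> b'\<close> and \<open>a' \<le> a\<close>.\<close>
    then have "(b * \<alpha>') * (a' * \<alpha>) \<le> (a * \<alpha>) * (b' * \<alpha>')"
      using mult_mono[of b b' a' a] le pos by (simp add: ac_simps)
    then have "(a * \<alpha> * k (F s) + b * \<alpha>') / (a' * \<alpha> * k (F s) + b' * \<alpha>')
        \<le> (a * \<alpha> * k (F t) + b * \<alpha>') / (a' * \<alpha> * k (F t) + b' * \<alpha>')"
      using pos k by (intro linear_fractional_mono) auto
    moreover have "R (F s) powr (a - a') \<le> R (F t) powr (a - a')"
      using R le by (intro powr_mono2) auto
    ultimately have "R (F s) powr (a - a') * ((a * \<alpha> * k (F s) + b * \<alpha>') / (a' * \<alpha> * k (F s) + b' * \<alpha>'))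
        \<le> R (F t) powr (a - a') * ((a * \<alpha> * k (F t) + b * \<alpha>') / (a' * \<alpha> * k (F t) + b' * \<alpha>'))"
      using pos k by (intro mult_mono) auto
    then have "?g s / ?g' s \<le> ?g t / ?g' t"
      using kw_min_density_ratio[of \<alpha> \<alpha>' a b a' b' F _ f] s' t' pos sum by (simp add: k_def R_def)
    \<comment> \<open>Both denominators are positive, so the \<open>ennreal\<close> quotients are
      the real ones.\<close>
    then show ?thesis
      using g_pos s' t' pos nonneg by (simp add: divide_ennreal ennreal_leI)
  qed
  then have "mono_on {t. \<not> (?g' t = 0 \<and> ?g t = 0)} (\<lambda>t. ennreal (?g t) / ennreal (?g' t))"
    by (intro mono_onI) auto
  then show ?thesis
    unfolding lr_le_def using X Y nonneg by blast
qed

section \<open>Majorization between two-valued vectors\<close>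

lemma sort_replicate_append:
  fixes x y :: "'a::linorder"
  assumes "x < y"
  shows "sort (replicate m x @ replicate n y) = replicate m x @ replicate n y"
    and "sort (replicate n y @ replicate m x) = replicate m x @ replicate n y"
proof -
  have sorted: "sorted (replicate m x @ replicate n y)"
    using assms by (auto simp: sorted_append)
  then show "sort (replicate m x @ replicate n y) = replicate m x @ replicate n y"
    by (rule sorted_sort_id)
  show "sort (replicate n y @ replicate m x) = replicate m x @ replicate n y"
    by (rule properties_for_sort) (use sorted in auto)
qed

theorem theorem3p5:
  fixes F f :: "real \<Rightarrow> real"
    and n1 n2 n :: nat
    and \<alpha> \<alpha>' \<beta> \<beta>' \<delta> \<delta>' :: real
    and M :: "'a measure" and N :: "'b measure"
    and U :: "nat \<Rightarrow> 'a \<Rightarrow> real" and V :: "nat \<Rightarrow> 'b \<Rightarrow> real"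
  assumes "distribution_function F"
    and "continuous_on UNIV F"
    and "has_density F f"
    and "n1 \<ge> 1" and "n2 \<ge> 1" and "n = n1 + n2"
    and "\<alpha> > 0" and "\<alpha>' > 0" and "\<beta> > 0" and "\<beta>' > 0" and "\<delta> > 0" and "\<delta>' > 0"
    and "prob_space M" and "prob_space N"
    and "prob_space.indep_vars M (\<lambda>_. borel) U {1..n}"
    and "prob_space.indep_vars N (\<lambda>_. borel) V {1..n}"
    and "\<And>i. i \<in> {1..n1} \<Longrightarrow> kw_G M (U i) \<alpha> \<beta> F"
    and "\<And>i. i \<in> {1..n1} \<Longrightarrow> kw_G N (V i) \<alpha> \<delta> F"
    and "\<And>i. i \<in> {n1 + 1..n} \<Longrightarrow> kw_G M (U i) \<alpha>' \<beta>' F"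
    and "\<And>i. i \<in> {n1 + 1..n} \<Longrightarrow> kw_G N (V i) \<alpha>' \<delta>' F"
    and "majorizes (replicate n1 \<beta> @ replicate n2 \<beta>') (replicate n1 \<delta> @ replicate n2 \<delta>')"
  shows "(\<alpha> > \<alpha>' \<and> \<beta> > \<beta>' \<and> \<delta> > \<delta>' \<longrightarrow> lr_le N (min_upto n V) M (min_upto n U)) \<and>
         (\<alpha> > \<alpha>' \<and> \<beta> < \<beta>' \<and> \<delta> < \<delta>' \<longrightarrow> lr_le M (min_upto n U) N (min_upto n V))"
proof -
  have dU: "distributed M lborel (min_upto n U)
      (\<lambda>t. ennreal (kw_min_density \<alpha> \<alpha>' (real n1 * \<beta>) (real n2 * \<beta>') F f t))"
    using assms by (intro prob_space.kw_min_distributed) auto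
  have dV: "distributed N lborel (min_upto n V)
      (\<lambda>t. ennreal (kw_min_density \<alpha> \<alpha>' (real n1 * \<delta>) (real n2 * \<delta>') F f t))"
    using assms by (intro prob_space.kw_min_distributed) auto
  have f: "0 \<le> f t" for t
    using assms(3) by (simp add: has_density_def)
  \<comment> \<open>Successor form exposes the head of each replicated list, so that
    \<open>take 1\<close> evaluates.\<close>
  obtain m1 m2 where m: "n1 = Suc m1" "n2 = Suc m2"
    using assms(4,5) by (metis Suc_le_D One_nat_def)
  have sum: "real n1 * \<beta> + real n2 * \<beta>' = real n1 * \<delta> + real n2 * \<delta>'"
    using assms(21) by (simp add: majorizes_def sum_list_replicate)
  \<comment> \<open>Both blocks are nonempty, so the length is at least 2 and \<open>j = 1\<close>
    is admissible; it compares the smallest entries.\<close>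
  have first: "sum_list (take 1 (sort (replicate n1 \<beta> @ replicate n2 \<beta>')))
      \<le> sum_list (take 1 (sort (replicate n1 \<delta> @ replicate n2 \<delta>')))"
    using assms(21) m by (auto simp: majorizes_def)
  have "lr_le N (min_upto n V) M (min_upto n U)" if "\<alpha> > \<alpha>'" "\<beta> > \<beta>'" "\<delta> > \<delta>'"
  proof -
    \<comment> \<open>Here the smallest entries sit in the second block; the equal sums convert
      their order into the reverse order on the first block.\<close>
    have "\<beta>' \<le> \<delta>'"
      using first that unfolding m by (simp only: sort_replicate_append(2)) simp
    then have "real n2 * \<beta>' \<le> real n2 * \<delta>'"
      by (simp add: mult_left_mono)
    with sum have "real n1 * \<delta> \<le> real n1 * \<beta>"
      by linarith
    then have "\<delta> \<le> \<beta>"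
      using m by simp
    then show ?thesis
      using assms that sum f by (intro lr_le_of_kw_min_densities[OF _ _ _ _ _ _ _ _ _ _ dU dV]) auto
  qed
  moreover have "lr_le M (min_upto n U) N (min_upto n V)" if "\<alpha> > \<alpha>'" "\<beta> < \<beta>'" "\<delta> < \<delta>'"
  proof -
    \<comment> \<open>Now the smallest entries sit in the first block, so \<open>V\<close> carries
      the larger weight on \<alpha> and takes the role of \<open>X\<close>.\<close>
    have "\<beta> \<le> \<delta>"
      using first that unfolding m by (simp only: sort_replicate_append(1)) simp
    then show ?thesis
      using assms that sum f by (intro lr_le_of_kw_min_densities[OF _ _ _ _ _ _ _ _ _ _ dV dU]) auto
  qed
  ultimately show ?thesis by blast
qed

end
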